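(* Let $L$ be a complete lattice. Then the set $\mathcal{D}(L)$ of all nonempty compact saturated subsets of the Scott space $(L,\sigma(L))$, partially ordered by reverse inclusion ($K_1\le K_2$ iff $K_1\supseteq K_2$), is a complete Heyting algebra.
   Context: For a poset $P$, a subset $U\subseteq P$ is Scott open if (i) $U$ is an upper set, i.e. $U={\uparrow}U=\{x\in P: y\le x\text{ for some }y\in U\}$, and (ii) for every (nonempty) directed subset $D\subseteq P$ whose supremum $\bigvee D$ exists, $\bigvee D\in U$ implies $D\cap U\neq\emptyset$. The Scott open sets form the Scott topology $\sigma(P)$, and $(P,\sigma(P))$ is the Scott space of $P$. A subset of a topological space is saturated if it equals the intersection of all open sets containing it. Compact means every open cover has a finite subcover (no Hausdorff condition). A complete Heyting algebra (also called a frame) is a complete lattice $A$ satisfying $a\wedge\bigvee\{a_i:i\in I\}=\bigvee\{a\wedge a_i:i\in I\}$ for all $a\in A$ and all families $\{a_i:i\in I\}\subseteq A$. *)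

theory Defs
  imports "HOL-Analysis.Abstract_Topology" "HOL-Algebra.Complete_Lattice"
begin

definition directed_in :: "('a, 'b) gorder_scheme \<Rightarrow> 'a set \<Rightarrow> bool"
  where "directed_in P D \<longleftrightarrow>
    D \<subseteq> carrier P \<and> D \<noteq> {} \<and> (\<forall>x\<in>D. \<forall>y\<in>D. \<exists>z\<in>D. x \<sqsubseteq>\<^bsub>P\<^esub> z \<and> y \<sqsubseteq>\<^bsub>P\<^esub> z)"

definition up_closure :: "('a, 'b) gorder_scheme \<Rightarrow> 'a set \<Rightarrow> 'a set"
  where "up_closure P U = {x \<in> carrier P. \<exists>y\<in>U. y \<sqsubseteq>\<^bsub>P\<^esub> x}"

definition scott_open :: "('a, 'b) gorder_scheme \<Rightarrow> 'a set \<Rightarrow> bool"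
  where "scott_open P U \<longleftrightarrow>
    U \<subseteq> carrier P \<and> U = up_closure P U \<and>
    (\<forall>D s. directed_in P D \<and> is_lub P s D \<and> s \<in> U \<longrightarrow> D \<inter> U \<noteq> {})"

definition scott_topology :: "('a, 'b) gorder_scheme \<Rightarrow> 'a topology"
  where "scott_topology P = topology (scott_open P)"

lemma scott_open_upward:
  "\<lbrakk>scott_open P U; x \<in> U; y \<in> carrier P; x \<sqsubseteq>\<^bsub>P\<^esub> y\<rbrakk> \<Longrightarrow> y \<in> U"
  unfolding scott_open_def up_closure_def by blast

lemma scott_open_inaccessible:
  "\<lbrakk>scott_open P U; directed_in P D; is_lub P s D; s \<in> U\<rbrakk> \<Longrightarrow> \<exists>x\<in>D. x \<in> U"
  unfolding scott_open_def by (metis disjoint_iff)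

lemma scott_openI:
  assumes "weak_partial_order P" "U \<subseteq> carrier P"
    and up: "\<And>x y. \<lbrakk>x \<in> U; y \<in> carrier P; x \<sqsubseteq>\<^bsub>P\<^esub> y\<rbrakk> \<Longrightarrow> y \<in> U"
    and inacc: "\<And>D s. \<lbrakk>directed_in P D; is_lub P s D; s \<in> U\<rbrakk> \<Longrightarrow> D \<inter> U \<noteq> {}"
  shows "scott_open P U"
proof -
  have "U = up_closure P U"
    using assms(2) up weak_partial_order.le_refl[OF assms(1)]
    unfolding up_closure_def by blast
  then show ?thesis
    using assms(2) inacc unfolding scott_open_def by blast
qed

lemma istopology_scott_open:
  assumes "weak_partial_order P"
  shows "istopology (scott_open P)"
  unfolding istopology_def
proof (intro conjI allI impI)
  fix S T assume S: "scott_open P S" and T: "scott_open P T"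
  show "scott_open P (S \<inter> T)"
  proof (rule scott_openI[OF assms])
    show "S \<inter> T \<subseteq> carrier P"
      using S unfolding scott_open_def by blast
    show "y \<in> S \<inter> T" if "x \<in> S \<inter> T" "y \<in> carrier P" "x \<sqsubseteq>\<^bsub>P\<^esub> y" for x y
      using that scott_open_upward[OF S] scott_open_upward[OF T] by blast
    fix D s assume D: "directed_in P D" "is_lub P s D" "s \<in> S \<inter> T"
    obtain x where x: "x \<in> D" "x \<in> S"
      using scott_open_inaccessible[OF S D(1,2)] D(3) by blast
    obtain y where y: "y \<in> D" "y \<in> T"
      using scott_open_inaccessible[OF T D(1,2)] D(3) by blast
    obtain z where z: "z \<in> D" "z \<in> carrier P" "x \<sqsubseteq>\<^bsub>P\<^esub> z" "y \<sqsubseteq>\<^bsub>P\<^esub> z"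
      using D(1) x(1) y(1) unfolding directed_in_def by blast
    show "D \<inter> (S \<inter> T) \<noteq> {}"
      using scott_open_upward[OF S x(2) z(2,3)] scott_open_upward[OF T y(2) z(2,4)] z(1) by blast
  qed
next
  fix \<K> assume K: "\<forall>K\<in>\<K>. scott_open P K"
  show "scott_open P (\<Union>\<K>)"
  proof (rule scott_openI[OF assms])
    show "\<Union>\<K> \<subseteq> carrier P"
      using K unfolding scott_open_def by blast
    show "y \<in> \<Union>\<K>" if "x \<in> \<Union>\<K>" "y \<in> carrier P" "x \<sqsubseteq>\<^bsub>P\<^esub> y" for x y
      using that K scott_open_upward by (metis UnionE UnionI)
    show "D \<inter> \<Union>\<K> \<noteq> {}" if D: "directed_in P D" "is_lub P s D" "s \<in> \<Union>\<K>" for D s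
    proof -
      obtain A where A: "A \<in> \<K>" "s \<in> A"
        using D(3) by blast
      then show ?thesis
        using scott_open_inaccessible[OF bspec[OF K A(1)] D(1,2) A(2)] by blast
    qed
  qed
qed

lemma openin_scott_topology:
  "weak_partial_order P \<Longrightarrow> openin (scott_topology P) U \<longleftrightarrow> scott_open P U"
  by (simp add: scott_topology_def istopology_scott_open)

lemma topspace_scott_topology:
  assumes "weak_partial_order P"
  shows "topspace (scott_topology P) = carrier P"
proof (rule subset_antisym)
  show "topspace (scott_topology P) \<subseteq> carrier P"
    unfolding topspace_def openin_scott_topology[OF assms] scott_open_def by blast
  have "scott_open P (carrier P)"
    by (rule scott_openI[OF assms]) (auto simp: directed_in_def)
  then show "carrier P \<subseteq> topspace (scott_topology P)"
    by (intro openin_subset) (simp add: openin_scott_topology assms)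
qed

text \<open>The guard \<^term>\<open>S \<subseteq> topspace X\<close> matters: otherwise no open set contains \<^term>\<open>S\<close>, and
  the empty intersection \<^term>\<open>UNIV\<close> would count as saturated even if it is not a subset of the space.\<close>

definition saturated_in :: "'a topology \<Rightarrow> 'a set \<Rightarrow> bool"
  where "saturated_in X S \<longleftrightarrow> S \<subseteq> topspace X \<and> S = \<Inter>{U. openin X U \<and> S \<subseteq> U}"

definition compact_saturated_order :: "'a topology \<Rightarrow> 'a set gorder"
  where "compact_saturated_order X =
    \<lparr>carrier = {K. K \<noteq> {} \<and> compactin X K \<and> saturated_in X K},
     eq = (=),
     le = (\<lambda>K\<^sub>1 K\<^sub>2. K\<^sub>1 \<supseteq> K\<^sub>2)\<rparr>"

locale complete_heyting_algebra = complete_lattice A for A (structure) +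
  assumes meet_sup_distrib:
    "\<lbrakk>a \<in> carrier A; S \<subseteq> carrier A\<rbrakk> \<Longrightarrow> a \<sqinter> \<Squnion>S = \<Squnion>((\<lambda>s. a \<sqinter> s) ` S)"

end

theory Submission
  imports Defs
begin

text \<open>In the order of reverse inclusion, joins are intersections and binary meets are unions, so
  the frame law is the distributivity of union over intersection; every nonempty upper set contains
  the top element. What has to be shown is that an arbitrary intersection of compact saturated sets
  of the Scott space is compact.

  Everything follows from one fact: if \<open>A\<close> is closed and \<open>K\<close> is compact saturated, then the lower
  set generated by \<open>A \<inter> K\<close> is closed. To see this, let \<open>D\<close> be a directed subset of it and
  choose a minimal closed \<open>B \<subseteq> A\<close> meeting every \<open>K \<inter> {x. d \<le> x}\<close> with \<open>d \<in> D\<close>. The set of all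
  \<open>y \<in> B\<close> with \<open>d \<squnion> y \<in> B\<close> is closed and meets the same sets, so by minimality it is \<open>B\<close>. For
  \<open>y \<in> B \<inter> K\<close> the join of \<open>y\<close> with the supremum of \<open>D\<close> thus lies in \<open>B \<inter> K\<close>. A second
  minimality argument gives that the Scott space is well-filtered, and two applications of
  compactness, to \<open>K\<^sub>1\<close> and to \<open>K\<^sub>2 \<inter> {y. x \<le> y}\<close> for a suitable \<open>x \<in> K\<^sub>1\<close>, give that
  \<open>K\<^sub>1 \<inter> K\<^sub>2\<close> is compact.\<close>

section \<open>Closed sets meeting compact sets\<close>

text \<open>Zorn's lemma, applied to the complements. If the union of a chain of open sets contained
  some \<open>K\<close>, compactness would leave finitely many of them, and the largest of these
  would already contain \<open>K\<close>.\<close>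

lemma minimal_closedin_meeting:
  assumes comp: "\<And>K. K \<in> \<K> \<Longrightarrow> compactin X K"
    and C: "closedin X C" "\<And>K. K \<in> \<K> \<Longrightarrow> C \<inter> K \<noteq> {}"
  obtains A where "closedin X A" "A \<subseteq> C" "\<And>K. K \<in> \<K> \<Longrightarrow> A \<inter> K \<noteq> {}"
    "\<And>B. \<lbrakk>closedin X B; B \<subseteq> A; \<And>K. K \<in> \<K> \<Longrightarrow> B \<inter> K \<noteq> {}\<rbrakk> \<Longrightarrow> B = A"
proof -
  \<comment> \<open>Complements of the candidate closed sets, so that a minimal closed set becomes a
    maximal open one.\<close>
  define \<A> where "\<A> = {U. openin X U \<and> topspace X - C \<subseteq> U \<and> (\<forall>K\<in>\<K>. \<not> K \<subseteq> U)}"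
  have "topspace X - C \<in> \<A>"
    using C by (auto simp: \<A>_def)
  moreover have "\<Union>\<C> \<in> \<A>" if ne: "\<C> \<noteq> {}" and ch: "subset.chain \<A> \<C>" for \<C>
  proof -
    have sub: "\<C> \<subseteq> \<A>"
      using ch by (simp add: subset_chain_def)
    have "\<not> K \<subseteq> \<Union>\<C>" if K: "K \<in> \<K>" for K
    proof
      assume "K \<subseteq> \<Union>\<C>"
      then obtain \<F> where F: "finite \<F>" "\<F> \<subseteq> \<C>" "K \<subseteq> \<Union>\<F>"
        using compactinD[OF comp[OF K], of \<C>] sub by (auto simp: \<A>_def)
      \<comment> \<open>An empty subcover would make \<open>K\<close> empty, but \<open>C\<close>
        meets \<open>K\<close>.\<close>
      have "\<F> \<noteq> {}"
        using F(3) C(2)[OF K] by auto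
      moreover have "subset.chain \<A> \<F>"
        using ch F(2) sub unfolding subset_chain_def by (meson subsetD subset_trans)
      ultimately have "\<Union>\<F> \<in> \<A>"
        using Union_in_chain[OF F(1)] F(2) sub by blast
      then show False
        using F(3) K by (auto simp: \<A>_def)
    qed
    then show ?thesis
      using sub ne by (auto simp: \<A>_def)
  qed
  ultimately obtain M where M: "M \<in> \<A>" "\<And>U. \<lbrakk>U \<in> \<A>; M \<subseteq> U\<rbrakk> \<Longrightarrow> U = M"
    using subset_Zorn_nonempty[of \<A>] by blast
  show thesis
  proof (rule that[of "topspace X - M"])
    show "closedin X (topspace X - M)"
      using M(1) by (auto simp: \<A>_def)
    show "topspace X - M \<subseteq> C"
      using M(1) by (auto simp: \<A>_def)
    show "(topspace X - M) \<inter> K \<noteq> {}" if "K \<in> \<K>" for K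
    proof -
      have "\<not> K \<subseteq> M"
        using that M(1) by (simp add: \<A>_def)
      then show ?thesis
        using compactin_subset_topspace[OF comp[OF that]] by blast
    qed
    fix B assume B: "closedin X B" "B \<subseteq> topspace X - M" "\<And>K. K \<in> \<K> \<Longrightarrow> B \<inter> K \<noteq> {}"
    have "M \<subseteq> topspace X"
      using M(1) by (auto simp: \<A>_def openin_subset)
    then have sub: "M \<subseteq> topspace X - B"
      using B(2) by blast
    have "\<not> K \<subseteq> topspace X - B" if "K \<in> \<K>" for K
      using B(3)[OF that] by blast
    then have "topspace X - B \<in> \<A>"
      using B(1) M(1) sub by (auto simp: \<A>_def)
    from this sub
    have "topspace X - B = M"
      by (rule M(2))
    then show "B = topspace X - M"
      using closedin_subset[OF B(1)] by auto
  qed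
qed

lemma compactin_meets_Inter:
  assumes "compactin X K" "\<And>C. C \<in> \<U> \<Longrightarrow> closedin X C"
    and "\<And>\<F>. \<lbrakk>finite \<F>; \<F> \<subseteq> \<U>\<rbrakk> \<Longrightarrow> K \<inter> \<Inter>\<F> \<noteq> {}"
  shows "K \<inter> \<Inter>\<U> \<noteq> {}"
proof -
  have "\<forall>\<U>. (\<forall>C\<in>\<U>. closedin X C) \<and> (\<forall>\<F>. finite \<F> \<and> \<F> \<subseteq> \<U> \<longrightarrow> K \<inter> \<Inter>\<F> \<noteq> {})
      \<longrightarrow> K \<inter> \<Inter>\<U> \<noteq> {}"
    using assms(1) by (simp add: compactin_fip)
  from spec[OF this, of \<U>] show ?thesis
    using assms(2,3) by simp
qed

section \<open>Closed and saturated sets of the Scott space\<close>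

context complete_lattice
begin

text \<open>Every directed set has a supremum here and suprema are unique, so the condition on
  \<open>is_lub\<close> can be stated with \<open>\<Squnion>D\<close>.\<close>

lemma closedin_scott:
  "closedin (scott_topology L) C \<longleftrightarrow>
    C \<subseteq> carrier L \<and> (\<forall>x\<in>C. \<forall>y\<in>carrier L. y \<sqsubseteq> x \<longrightarrow> y \<in> C) \<and>
    (\<forall>D. directed_in L D \<and> D \<subseteq> C \<longrightarrow> \<Squnion>D \<in> C)"
    (is "?l \<longleftrightarrow> ?r")
proof
  assume l: ?l
  then have C: "C \<subseteq> carrier L" and U: "scott_open L (carrier L - C)"
    by (simp_all add: closedin_def topspace_scott_topology openin_scott_topology
        weak_partial_order_axioms)
  have "y \<in> C" if "x \<in> C" "y \<in> carrier L" "y \<sqsubseteq> x" for x y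
    using scott_open_upward[OF U, of y x] that C by blast
  moreover have "\<Squnion>D \<in> C" if D: "directed_in L D" "D \<subseteq> C" for D
  proof (rule ccontr)
    have sub: "D \<subseteq> carrier L"
      using D C by blast
    assume "\<Squnion>D \<notin> C"
    then show False
      using scott_open_inaccessible[OF U D(1) sup_lub[OF sub]] sub D(2) by auto
  qed
  ultimately show ?r
    using C by blast
next
  assume r: ?r
  have "scott_open L (carrier L - C)"
  proof (rule scott_openI[OF weak_partial_order_axioms])
    show "y \<in> carrier L - C" if "x \<in> carrier L - C" "y \<in> carrier L" "x \<sqsubseteq> y" for x y
      using that r by blast
    fix D s assume D: "directed_in L D" "is_lub L s D" "s \<in> carrier L - C"
    have "D \<subseteq> carrier L"
      using D(1) by (simp add: directed_in_def)
    then have "s = \<Squnion>D"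
      using D(2) sup_lub least_unique by blast
    then show "D \<inter> (carrier L - C) \<noteq> {}"
      using r D \<open>D \<subseteq> carrier L\<close> by blast
  qed auto
  then show ?l
    using r by (simp add: closedin_def topspace_scott_topology openin_scott_topology
        weak_partial_order_axioms)
qed

lemma closedin_scott_lower:
  "\<lbrakk>closedin (scott_topology L) C; x \<in> C; y \<in> carrier L; y \<sqsubseteq> x\<rbrakk> \<Longrightarrow> y \<in> C"
  unfolding closedin_scott by blast

lemma closedin_scott_sup:
  "\<lbrakk>closedin (scott_topology L) C; directed_in L D; D \<subseteq> C\<rbrakk> \<Longrightarrow> \<Squnion>D \<in> C"
  unfolding closedin_scott by blast

lemma closedin_scott_carrier: "closedin (scott_topology L) C \<Longrightarrow> C \<subseteq> carrier L"
  unfolding closedin_scott by blast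

lemma closedin_scott_principal:
  assumes "x \<in> carrier L"
  shows "closedin (scott_topology L) {y \<in> carrier L. y \<sqsubseteq> x}"
  unfolding closedin_scott
proof (intro conjI allI impI ballI)
  fix D assume "directed_in L D \<and> D \<subseteq> {y \<in> carrier L. y \<sqsubseteq> x}"
  then have "D \<subseteq> carrier L" "\<And>d. d \<in> D \<Longrightarrow> d \<sqsubseteq> x"
    by auto
  then show "\<Squnion>D \<in> {y \<in> carrier L. y \<sqsubseteq> x}"
    using assms by (auto intro!: sup_least)
qed (use assms in \<open>auto intro: le_trans\<close>)

text \<open>Scott open sets are upper sets, and so are their intersections. Conversely, for
  \<open>x\<close> outside an upper set \<open>K\<close>, the complement of the principal ideal of
  \<open>x\<close> is Scott open, contains \<open>K\<close> and omits \<open>x\<close>.\<close>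

lemma saturated_in_scott:
  "saturated_in (scott_topology L) K \<longleftrightarrow>
    K \<subseteq> carrier L \<and> (\<forall>x\<in>K. \<forall>y\<in>carrier L. x \<sqsubseteq> y \<longrightarrow> y \<in> K)"
    (is "?l \<longleftrightarrow> ?r")
proof
  assume l: ?l
  then have K: "K \<subseteq> carrier L" and eq: "K = \<Inter>{U. openin (scott_topology L) U \<and> K \<subseteq> U}"
    by (simp_all add: saturated_in_def topspace_scott_topology weak_partial_order_axioms)
  have "y \<in> K" if "x \<in> K" "y \<in> carrier L" "x \<sqsubseteq> y" for x y
  proof -
    have "y \<in> U" if "openin (scott_topology L) U" "K \<subseteq> U" for U
      using that \<open>x \<in> K\<close> \<open>y \<in> carrier L\<close> \<open>x \<sqsubseteq> y\<close> scott_open_upward[of L U x y]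
      by (auto simp: openin_scott_topology weak_partial_order_axioms)
    then show ?thesis
      by (subst eq) blast
  qed
  with K show ?r
    by blast
next
  assume r: ?r
  have "x \<in> K" if x: "\<And>U. \<lbrakk>openin (scott_topology L) U; K \<subseteq> U\<rbrakk> \<Longrightarrow> x \<in> U" for x
  proof (rule ccontr)
    assume "x \<notin> K"
    have "x \<in> carrier L"
      using x[of "carrier L"] r openin_topspace[of "scott_topology L"]
      by (simp add: topspace_scott_topology weak_partial_order_axioms)
    let ?U = "carrier L - {y \<in> carrier L. y \<sqsubseteq> x}"
    have "openin (scott_topology L) ?U"
      using closedin_scott_principal[OF \<open>x \<in> carrier L\<close>]
      by (simp add: closedin_def topspace_scott_topology weak_partial_order_axioms)
    moreover have "K \<subseteq> ?U"
      using r \<open>x \<notin> K\<close> \<open>x \<in> carrier L\<close> by blast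
    ultimately show False
      using x \<open>x \<in> carrier L\<close> by auto
  qed
  then have "\<Inter>{U. openin (scott_topology L) U \<and> K \<subseteq> U} \<subseteq> K"
    by (intro subsetI) simp
  moreover have "K \<subseteq> \<Inter>{U. openin (scott_topology L) U \<and> K \<subseteq> U}"
    by (intro Inter_greatest) simp
  ultimately show ?l
    using r by (simp add: saturated_in_def topspace_scott_topology weak_partial_order_axioms)
qed

section \<open>Scott continuity of joining with a fixed element\<close>

lemma join_right_mono:
  assumes "x \<in> carrier L" "y \<in> carrier L" "z \<in> carrier L" "y \<sqsubseteq> z"
  shows "x \<squnion> y \<sqsubseteq> x \<squnion> z"
proof (rule join_le[OF join_left])
  show "y \<sqsubseteq> x \<squnion> z"
    using le_trans[OF assms(4) join_right[OF assms(1,3)]] assms by simp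
qed (use assms in simp_all)

lemma directed_in_image_join:
  assumes D: "directed_in L D" and x: "x \<in> carrier L"
  shows "directed_in L ((\<lambda>d. x \<squnion> d) ` D)"
proof -
  have sub: "D \<subseteq> carrier L" and ne: "D \<noteq> {}"
    using D by (auto simp: directed_in_def)
  have mono: "x \<squnion> d \<sqsubseteq> x \<squnion> e" if "d \<in> D" "e \<in> D" "d \<sqsubseteq> e" for d e
    using that sub x by (intro join_right_mono) auto
  have "\<exists>e\<in>D. x \<squnion> a \<sqsubseteq> x \<squnion> e \<and> x \<squnion> b \<sqsubseteq> x \<squnion> e" if "a \<in> D" "b \<in> D" for a b
    using D that mono unfolding directed_in_def by meson
  then show ?thesis
    using sub ne x unfolding directed_in_def by auto
qed

text \<open>Both sides are the least upper bound of \<open>x\<close> together with \<open>D\<close>.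
  A member \<open>d\<close> of \<open>D\<close> supplies the term \<open>x \<squnion> d\<close> that
  puts \<open>x\<close> below the right-hand side.\<close>

lemma join_Sup:
  assumes D: "D \<subseteq> carrier L" "D \<noteq> {}" and x: "x \<in> carrier L"
  shows "x \<squnion> \<Squnion>D = \<Squnion>((\<lambda>d. x \<squnion> d) ` D)"
proof (rule le_antisym)
  have I: "(\<lambda>d. x \<squnion> d) ` D \<subseteq> carrier L"
    using D x by auto
  show "x \<squnion> \<Squnion>D \<in> carrier L" "\<Squnion>((\<lambda>d. x \<squnion> d) ` D) \<in> carrier L"
    using D x I by auto
  have up: "x \<squnion> d \<sqsubseteq> \<Squnion>((\<lambda>d. x \<squnion> d) ` D)" if "d \<in> D" for d
    using sup_upper[OF I] that by blast
  have "x \<sqsubseteq> \<Squnion>((\<lambda>d. x \<squnion> d) ` D)"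
  proof -
    obtain d where "d \<in> D"
      using D(2) by blast
    moreover from this have "d \<in> carrier L"
      using D(1) by blast
    ultimately show ?thesis
      using le_trans[OF join_left up] x I by simp
  qed
  moreover have "\<Squnion>D \<sqsubseteq> \<Squnion>((\<lambda>d. x \<squnion> d) ` D)"
  proof (rule sup_least)
    show "d \<sqsubseteq> \<Squnion>((\<lambda>d. x \<squnion> d) ` D)" if "d \<in> D" for d
      using le_trans[OF join_right up[OF that]] subsetD[OF D(1) that] x I by simp
  qed (use D I in auto)
  ultimately show "x \<squnion> \<Squnion>D \<sqsubseteq> \<Squnion>((\<lambda>d. x \<squnion> d) ` D)"
    using D x I by (intro join_le) auto
  show "\<Squnion>((\<lambda>d. x \<squnion> d) ` D) \<sqsubseteq> x \<squnion> \<Squnion>D"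
  proof (rule sup_least[OF I])
    show "x \<squnion> \<Squnion>D \<in> carrier L"
      using D x by auto
    fix z assume "z \<in> (\<lambda>d. x \<squnion> d) ` D"
    then obtain d where d: "d \<in> D" "z = x \<squnion> d"
      by blast
    show "z \<sqsubseteq> x \<squnion> \<Squnion>D"
      unfolding d(2) using d(1) D x by (intro join_right_mono sup_upper) auto
  qed
qed

text \<open>The set is the preimage of \<open>A\<close> under joining with \<open>x\<close>, a
  monotone map that preserves directed suprema.\<close>

lemma closedin_scott_join:
  assumes A: "closedin (scott_topology L) A" and x: "x \<in> carrier L"
  shows "closedin (scott_topology L) {y \<in> carrier L. x \<squnion> y \<in> A}"
  unfolding closedin_scott
proof (intro conjI allI impI ballI)
  fix y z assume "y \<in> {y \<in> carrier L. x \<squnion> y \<in> A}" "z \<in> carrier L" "z \<sqsubseteq> y"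
  then have "x \<squnion> z \<sqsubseteq> x \<squnion> y" "x \<squnion> y \<in> A"
    using x by (auto intro: join_right_mono)
  then show "z \<in> {y \<in> carrier L. x \<squnion> y \<in> A}"
    using closedin_scott_lower[OF A] x \<open>z \<in> carrier L\<close> by auto
next
  fix D assume D: "directed_in L D \<and> D \<subseteq> {y \<in> carrier L. x \<squnion> y \<in> A}"
  then have "D \<subseteq> carrier L" "D \<noteq> {}"
    by (auto simp: directed_in_def)
  moreover have "\<Squnion>((\<lambda>d. x \<squnion> d) ` D) \<in> A"
    using D x by (intro closedin_scott_sup[OF A] directed_in_image_join) auto
  ultimately show "\<Squnion>D \<in> {y \<in> carrier L. x \<squnion> y \<in> A}"
    using join_Sup x by auto
qed auto

lemma continuous_map_scott_join:
  assumes "x \<in> carrier L"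
  shows "continuous_map (scott_topology L) (scott_topology L) (\<lambda>y. x \<squnion> y)"
  using assms closedin_scott_join
  by (auto simp: continuous_map_closedin topspace_scott_topology weak_partial_order_axioms)

section \<open>Compact saturated sets and well-filteredness\<close>

abbreviation compact_saturated :: "'a set \<Rightarrow> bool"
  where "compact_saturated K \<equiv>
    compactin (scott_topology L) K \<and> saturated_in (scott_topology L) K"

lemma saturated_in_scott_upward:
  "\<lbrakk>saturated_in (scott_topology L) K; x \<in> K; y \<in> carrier L; x \<sqsubseteq> y\<rbrakk> \<Longrightarrow> y \<in> K"
  unfolding saturated_in_scott by blast

lemma saturated_in_scott_carrier: "saturated_in (scott_topology L) K \<Longrightarrow> K \<subseteq> carrier L"
  unfolding saturated_in_scott by blast

text \<open>The set is the continuous image of \<open>K\<close> under joining with \<open>x\<close>: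
  the image stays in the upper set \<open>K\<close>, and elements above \<open>x\<close> are
  fixed.\<close>

lemma compactin_above:
  assumes K: "compact_saturated K" and x: "x \<in> carrier L"
  shows "compactin (scott_topology L) {y \<in> K. x \<sqsubseteq> y}"
proof -
  have sub: "K \<subseteq> carrier L"
    using K saturated_in_scott_carrier by blast
  have "x \<squnion> y \<in> {y \<in> K. x \<sqsubseteq> y}" if "y \<in> K" for y
    using saturated_in_scott_upward[of K y "x \<squnion> y"] K x that sub
    by (auto simp: join_left join_right)
  moreover have "y \<in> (\<lambda>y. x \<squnion> y) ` K" if "y \<in> K" "x \<sqsubseteq> y" for y
  proof
    show "y = x \<squnion> y"
      using that le_iff_meet[of x y] x sub by auto
  qed (rule that(1))
  ultimately have "{y \<in> K. x \<sqsubseteq> y} = (\<lambda>y. x \<squnion> y) ` K"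
    by blast
  then show ?thesis
    using image_compactin[OF _ continuous_map_scott_join[OF x], of K] K by simp
qed

text \<open>Only closure under directed suprema is at issue. For a minimal closed
  \<open>B \<subseteq> A\<close> as below and \<open>y \<in> B \<inter> K\<close>, the element
  \<open>y \<squnion> \<Squnion>D\<close> lies in \<open>A \<inter> K\<close> above
  \<open>\<Squnion>D\<close>.\<close>

lemma closedin_below_Int:
  assumes A: "closedin (scott_topology L) A" and K: "compact_saturated K"
  shows "closedin (scott_topology L) {x \<in> carrier L. \<exists>a \<in> A \<inter> K. x \<sqsubseteq> a}"
  unfolding closedin_scott
proof (intro conjI allI impI ballI)
  have subA: "A \<subseteq> carrier L"
    by (rule closedin_scott_carrier[OF A])
  show "y \<in> {x \<in> carrier L. \<exists>a \<in> A \<inter> K. x \<sqsubseteq> a}"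
    if x: "x \<in> {x \<in> carrier L. \<exists>a \<in> A \<inter> K. x \<sqsubseteq> a}" and y: "y \<in> carrier L" "y \<sqsubseteq> x" for x y
  proof -
    obtain a where a: "a \<in> A \<inter> K" "x \<sqsubseteq> a" and "x \<in> carrier L"
      using x by blast
    then have "y \<sqsubseteq> a"
      using le_trans[OF y(2)] y(1) subA by blast
    then show ?thesis
      using a y(1) by blast
  qed
  fix D assume "directed_in L D \<and> D \<subseteq> {x \<in> carrier L. \<exists>a \<in> A \<inter> K. x \<sqsubseteq> a}"
  then have D: "directed_in L D" "D \<subseteq> carrier L" "D \<noteq> {}"
    and below: "\<And>d. d \<in> D \<Longrightarrow> \<exists>a \<in> A \<inter> K. d \<sqsubseteq> a"
    by (auto simp: directed_in_def)
  define \<K> where "\<K> = (\<lambda>d. {y \<in> K. d \<sqsubseteq> y}) ` D"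
  have "compactin (scott_topology L) S" if "S \<in> \<K>" for S
    using that compactin_above[OF K] D(2) by (auto simp: \<K>_def)
  moreover have "A \<inter> S \<noteq> {}" if "S \<in> \<K>" for S
    using that below by (fastforce simp: \<K>_def)
  ultimately obtain B where B: "closedin (scott_topology L) B" "B \<subseteq> A"
      "\<And>S. S \<in> \<K> \<Longrightarrow> B \<inter> S \<noteq> {}"
    and min: "\<And>C. \<lbrakk>closedin (scott_topology L) C; C \<subseteq> B; \<And>S. S \<in> \<K> \<Longrightarrow> C \<inter> S \<noteq> {}\<rbrakk> \<Longrightarrow> C = B"
    using minimal_closedin_meeting[OF _ A] by metis
  have subB: "B \<subseteq> carrier L"
    by (rule closedin_scott_carrier[OF B(1)])
  have join_mem: "d \<squnion> y \<in> B" if d: "d \<in> D" and y: "y \<in> B" for d y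
  proof -
    have dc: "d \<in> carrier L"
      using d D by blast
    let ?C = "{y \<in> carrier L. d \<squnion> y \<in> B}"
    have C: "closedin (scott_topology L) ?C"
      by (rule closedin_scott_join[OF B(1) dc])
    have "?C = B"
    proof (rule min[OF C])
      show "?C \<subseteq> B"
        using closedin_scott_lower[OF B(1)] join_right dc by blast
      fix S assume "S \<in> \<K>"
      then obtain e where e: "e \<in> D" "S = {y \<in> K. e \<sqsubseteq> y}"
        by (auto simp: \<K>_def)
      \<comment> \<open>A point \<open>z\<close> of \<open>B \<inter> K\<close> above
        \<open>f\<close> absorbs \<open>d\<close> and lies above \<open>e\<close>, so it witnesses
        that \<open>?C\<close> meets \<open>S\<close>.\<close>
      obtain f where f: "f \<in> D" "d \<sqsubseteq> f" "e \<sqsubseteq> f"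
        using D(1) d e(1) unfolding directed_in_def by blast
      obtain z where z: "z \<in> B" "z \<in> K" "f \<sqsubseteq> z"
        using B(3)[of "{y \<in> K. f \<sqsubseteq> y}"] f(1) by (auto simp: \<K>_def)
      have car: "e \<in> carrier L" "f \<in> carrier L" "z \<in> carrier L"
        using e(1) f(1) z(1) D(2) subB by auto
      have "d \<sqsubseteq> z" "e \<sqsubseteq> z"
        using f z car dc le_trans by blast+
      moreover from this have "d \<squnion> z = z"
        using le_iff_meet dc car by blast
      ultimately have "z \<in> ?C \<inter> S"
        using z car e by auto
      then show "?C \<inter> S \<noteq> {}"
        by blast
    qed
    then show ?thesis
      using y by blast
  qed
  obtain d where d: "d \<in> D"
    using D(3) by blast
  obtain y where y: "y \<in> B" "y \<in> K"
    using B(3)[of "{y \<in> K. d \<sqsubseteq> y}"] d by (auto simp: \<K>_def)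
  have yc: "y \<in> carrier L" and sc: "\<Squnion>D \<in> carrier L"
    using y(1) subB D(2) by auto
  \<comment> \<open>The roles are exchanged: \<open>y\<close> is now fixed, and the closed set of
    all \<open>z\<close> with \<open>y \<squnion> z \<in> B\<close> contains
    \<open>D\<close>.\<close>
  have "\<Squnion>D \<in> {z \<in> carrier L. y \<squnion> z \<in> B}"
    using join_mem y(1) D join_comm[of L y]
    by (intro closedin_scott_sup[OF closedin_scott_join[OF B(1) yc] D(1)]) auto
  moreover have "y \<squnion> \<Squnion>D \<in> K"
    using saturated_in_scott_upward[of K y] K y(2) yc sc by (simp add: join_left)
  ultimately show "\<Squnion>D \<in> {x \<in> carrier L. \<exists>a \<in> A \<inter> K. x \<sqsubseteq> a}"
    using join_right[OF yc sc] sc B(2) by blast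
qed auto

text \<open>Well-filteredness, with \<open>C\<close> as the complement of an open set. A minimal
  closed \<open>A \<subseteq> C\<close> meeting all members turns out to be directed, so it has a
  greatest element, which lies in every member.\<close>

lemma scott_well_filtered:
  assumes ne: "\<K> \<noteq> {}" and K: "\<And>K. K \<in> \<K> \<Longrightarrow> compact_saturated K"
    and filt: "\<And>K\<^sub>1 K\<^sub>2. \<lbrakk>K\<^sub>1 \<in> \<K>; K\<^sub>2 \<in> \<K>\<rbrakk> \<Longrightarrow> \<exists>K\<in>\<K>. K \<subseteq> K\<^sub>1 \<inter> K\<^sub>2"
    and C: "closedin (scott_topology L) C" "\<And>K. K \<in> \<K> \<Longrightarrow> C \<inter> K \<noteq> {}"
  shows "C \<inter> \<Inter>\<K> \<noteq> {}"
proof -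
  obtain A where A: "closedin (scott_topology L) A" "A \<subseteq> C" "\<And>K. K \<in> \<K> \<Longrightarrow> A \<inter> K \<noteq> {}"
    and min: "\<And>B. \<lbrakk>closedin (scott_topology L) B; B \<subseteq> A; \<And>K. K \<in> \<K> \<Longrightarrow> B \<inter> K \<noteq> {}\<rbrakk> \<Longrightarrow> B = A"
    using minimal_closedin_meeting[OF _ C] K by metis
  have subA: "A \<subseteq> carrier L"
    by (rule closedin_scott_carrier[OF A(1)])
  have below: "\<exists>a \<in> A \<inter> K. x \<sqsubseteq> a" if "K \<in> \<K>" "x \<in> A" for K x
  proof -
    let ?B = "{x \<in> carrier L. \<exists>a \<in> A \<inter> K. x \<sqsubseteq> a}"
    \<comment> \<open>The lower set generated by \<open>A \<inter> K\<close> meets each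
      \<open>K'\<close> because \<open>A\<close> meets a common refinement of \<open>K\<close> and
      \<open>K'\<close>. Minimality then makes \<open>A \<inter> K\<close> cofinal in
      \<open>A\<close>.\<close>
    have "?B = A"
    proof (rule min)
      show "closedin (scott_topology L) ?B"
        using closedin_below_Int[OF A(1)] K that(1) by blast
      show "?B \<subseteq> A"
        by (auto intro: closedin_scott_lower[OF A(1)])
      fix K' assume "K' \<in> \<K>"
      then obtain K'' where K'': "K'' \<in> \<K>" "K'' \<subseteq> K \<inter> K'"
        using filt[OF \<open>K \<in> \<K>\<close>] by meson
      then obtain z where "z \<in> A" "z \<in> K''"
        using A(3) by blast
      moreover from this have "z \<in> carrier L" "z \<sqsubseteq> z"
        using subA le_refl by auto
      ultimately have "z \<in> ?B \<inter> K'"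
        using K'' by blast
      then show "?B \<inter> K' \<noteq> {}"
        by blast
    qed
    then show ?thesis
      using that(2) by blast
  qed
  have join_mem: "x \<squnion> y \<in> A" if x: "x \<in> A" and y: "y \<in> A" for x y
  proof -
    have xc: "x \<in> carrier L"
      using x subA by blast
    let ?B = "{y \<in> carrier L. x \<squnion> y \<in> A}"
    \<comment> \<open>Each \<open>K\<close> contains some \<open>a \<in> A\<close> above
      \<open>x\<close>; it absorbs \<open>x\<close> and so lies in \<open>?B\<close>.\<close>
    have "?B = A"
    proof (rule min)
      show "closedin (scott_topology L) ?B"
        by (rule closedin_scott_join[OF A(1) xc])
      show "?B \<subseteq> A"
        using closedin_scott_lower[OF A(1)] join_right xc by blast
      fix K assume "K \<in> \<K>"
      then obtain a where a: "a \<in> A" "a \<in> K" "x \<sqsubseteq> a"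
        using below x by blast
      then have "x \<squnion> a = a"
        using le_iff_meet xc subA by blast
      then show "?B \<inter> K \<noteq> {}"
        using a subA by auto
    qed
    then show ?thesis
      using y by blast
  qed
  have "A \<noteq> {}"
    using ne A(3) by blast
  then have "directed_in L A"
    using subA join_mem join_left join_right unfolding directed_in_def by (meson subsetD)
  then have sup: "\<Squnion>A \<in> A"
    by (intro closedin_scott_sup[OF A(1)]) auto
  have "\<Squnion>A \<in> K" if "K \<in> \<K>" for K
  proof -
    obtain a where "a \<in> A" "a \<in> K"
      using A(3) \<open>K \<in> \<K>\<close> by blast
    then show ?thesis
      using saturated_in_scott_upward[of K a "\<Squnion>A"] K that sup_upper[OF subA] sup subA by blast
  qed
  then show ?thesis
    using sup A(2) by blast
qed

section \<open>Intersections of compact saturated sets\<close>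

text \<open>Compactness of \<open>K\<^sub>1\<close> yields one \<open>x\<close> above which
  \<open>K\<^sub>2\<close> meets all finite intersections of the closed family. Compactness of the
  part of \<open>K\<^sub>2\<close> above \<open>x\<close> yields a common point, which is in
  \<open>K\<^sub>1\<close> because it is above \<open>x\<close>.\<close>

lemma compact_saturated_Int:
  assumes K1: "compact_saturated K\<^sub>1" and K2: "compact_saturated K\<^sub>2"
  shows "compact_saturated (K\<^sub>1 \<inter> K\<^sub>2)"
proof
  have sub: "K\<^sub>1 \<subseteq> carrier L" "K\<^sub>2 \<subseteq> carrier L"
    using K1 K2 saturated_in_scott_carrier by auto
  show "saturated_in (scott_topology L) (K\<^sub>1 \<inter> K\<^sub>2)"
    using K1 K2 unfolding saturated_in_scott by blast
  show "compactin (scott_topology L) (K\<^sub>1 \<inter> K\<^sub>2)"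
    unfolding compactin_fip
  proof (intro conjI allI impI; (elim conjE)?)
    show "K\<^sub>1 \<inter> K\<^sub>2 \<subseteq> topspace (scott_topology L)"
      using sub by (auto simp: topspace_scott_topology weak_partial_order_axioms)
    fix \<U>
    assume cl: "\<forall>C\<in>\<U>. closedin (scott_topology L) C"
      and fip: "\<forall>\<F>. finite \<F> \<and> \<F> \<subseteq> \<U> \<longrightarrow> K\<^sub>1 \<inter> K\<^sub>2 \<inter> \<Inter>\<F> \<noteq> {}"
    \<comment> \<open>Intersecting with \<open>carrier L\<close> keeps the set closed for the empty
      family, where \<open>\<Inter>{}\<close> is \<open>UNIV\<close>.\<close>
    define B where "B = (\<lambda>\<F>. {x \<in> carrier L. \<exists>a \<in> (carrier L \<inter> \<Inter>\<F>) \<inter> K\<^sub>2. x \<sqsubseteq> a})"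
    have "K\<^sub>1 \<inter> \<Inter>(B ` {\<F>. finite \<F> \<and> \<F> \<subseteq> \<U>}) \<noteq> {}"
    proof (rule compactin_meets_Inter)
      show "compactin (scott_topology L) K\<^sub>1"
        using K1 by blast
      show "closedin (scott_topology L) C" if C: "C \<in> B ` {\<F>. finite \<F> \<and> \<F> \<subseteq> \<U>}" for C
      proof -
        obtain \<F> where F: "C = B \<F>" "finite \<F>" "\<F> \<subseteq> \<U>"
          using C by blast
        have "closedin (scott_topology L) (\<Inter>(insert (carrier L) \<F>))"
        proof (rule closedin_Inter)
          have "closedin (scott_topology L) (carrier L)"
            using closedin_topspace[of "scott_topology L"]
            by (simp add: topspace_scott_topology weak_partial_order_axioms)
          then show "closedin (scott_topology L) S" if "S \<in> insert (carrier L) \<F>" for S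
            using that cl F(3) by blast
        qed simp
        then show ?thesis
          using closedin_below_Int[OF _ K2] F(1) by (simp add: B_def)
      qed
      fix \<V> assume "finite \<V>" "\<V> \<subseteq> B ` {\<F>. finite \<F> \<and> \<F> \<subseteq> \<U>}"
      then obtain \<G> where G: "\<G> \<subseteq> {\<F>. finite \<F> \<and> \<F> \<subseteq> \<U>}" "finite \<G>" "\<V> = B ` \<G>"
        by (meson finite_subset_image)
      \<comment> \<open>Finitely many finite subfamilies merge into one; a point of
        \<open>K\<^sub>1 \<inter> K\<^sub>2\<close> in its intersection is its own witness for each
        \<open>B \<F>\<close>.\<close>
      then have "finite (\<Union>\<G>) \<and> \<Union>\<G> \<subseteq> \<U>"
        by blast
      then have "K\<^sub>1 \<inter> K\<^sub>2 \<inter> \<Inter>(\<Union>\<G>) \<noteq> {}"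
        using fip by simp
      then obtain x where x: "x \<in> K\<^sub>1" "x \<in> K\<^sub>2" "x \<in> \<Inter>(\<Union>\<G>)"
        by blast
      moreover have "x \<sqsubseteq> x"
        using x(1) sub(1) le_refl by blast
      ultimately have "x \<in> \<Inter>\<V>"
        using sub unfolding G(3) B_def by blast
      then show "K\<^sub>1 \<inter> \<Inter>\<V> \<noteq> {}"
        using x by blast
    qed
    then obtain x where x: "x \<in> K\<^sub>1" "\<And>\<F>. \<lbrakk>finite \<F>; \<F> \<subseteq> \<U>\<rbrakk> \<Longrightarrow> x \<in> B \<F>"
      by blast
    have "{y \<in> K\<^sub>2. x \<sqsubseteq> y} \<inter> \<Inter>\<U> \<noteq> {}"
    proof (rule compactin_meets_Inter)
      show "compactin (scott_topology L) {y \<in> K\<^sub>2. x \<sqsubseteq> y}"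
        using compactin_above[OF K2] x(1) sub by blast
      show "{y \<in> K\<^sub>2. x \<sqsubseteq> y} \<inter> \<Inter>\<F> \<noteq> {}" if "finite \<F>" "\<F> \<subseteq> \<U>" for \<F>
        using x(2)[OF that] by (auto simp: B_def)
    qed (use cl in blast)
    then obtain y where y: "y \<in> K\<^sub>2" "x \<sqsubseteq> y" "y \<in> \<Inter>\<U>"
      by blast
    then have "y \<in> K\<^sub>1"
      using saturated_in_scott_upward[of K\<^sub>1 x y] K1 x(1) sub by blast
    then show "K\<^sub>1 \<inter> K\<^sub>2 \<inter> \<Inter>\<U> \<noteq> {}"
      using y by blast
  qed
qed

lemma compact_saturated_finite_Inter:
  assumes "finite \<F>" "\<F> \<noteq> {}" "\<And>K. K \<in> \<F> \<Longrightarrow> compact_saturated K"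
  shows "compact_saturated (\<Inter>\<F>)"
  using assms
proof (induction \<F> rule: finite_ne_induct)
  case (insert K \<F>)
  then show ?case
    using compact_saturated_Int[of K "\<Inter>\<F>"] by simp
qed simp

text \<open>Closing the family under finite intersections makes it filtered. By well-filteredness
  one such finite intersection lies inside the union of the cover, and its finite subcover serves
  for \<open>\<Inter>\<K>\<close>.\<close>

lemma compact_saturated_Inter:
  assumes ne: "\<K> \<noteq> {}" and K: "\<And>K. K \<in> \<K> \<Longrightarrow> compact_saturated K"
  shows "compact_saturated (\<Inter>\<K>)"
proof
  show "saturated_in (scott_topology L) (\<Inter>\<K>)"
    using K ne unfolding saturated_in_scott by blast
  then have sub: "\<Inter>\<K> \<subseteq> topspace (scott_topology L)"
    by (simp add: saturated_in_def)
  show "compactin (scott_topology L) (\<Inter>\<K>)"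
    unfolding compactin_def
  proof (intro conjI allI impI sub)
    fix \<U> assume U: "Ball \<U> (openin (scott_topology L)) \<and> \<Inter>\<K> \<subseteq> \<Union>\<U>"
    \<comment> \<open>The condition \<open>\<F> \<noteq> {}\<close> keeps out
      \<open>\<Inter>{}\<close>, which is \<open>UNIV\<close>.\<close>
    define \<G> where "\<G> = Inter ` {\<F>. finite \<F> \<and> \<F> \<noteq> {} \<and> \<F> \<subseteq> \<K>}"
    let ?C = "topspace (scott_topology L) - \<Union>\<U>"
    have G: "compact_saturated S" if "S \<in> \<G>" for S
      using that compact_saturated_finite_Inter K unfolding \<G>_def by blast
    have single: "S \<in> \<G>" if "S \<in> \<K>" for S
      unfolding \<G>_def by (rule image_eqI[of _ _ "{S}"]) (use that in auto)
    have "\<exists>S\<in>\<G>. S \<subseteq> \<Union>\<U>"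
    proof (rule ccontr)
      assume "\<not> (\<exists>S\<in>\<G>. S \<subseteq> \<Union>\<U>)"
      then have meets: "?C \<inter> S \<noteq> {}" if "S \<in> \<G>" for S
        using that compactin_subset_topspace[of "scott_topology L" S] G by blast
      have "?C \<inter> \<Inter>\<G> \<noteq> {}"
      proof (rule scott_well_filtered[OF _ G _ _ meets])
        show "\<G> \<noteq> {}"
          using ne single by blast
        show "closedin (scott_topology L) ?C"
          using U by (intro closedin_diff) auto
        fix S T assume "S \<in> \<G>" "T \<in> \<G>"
        then obtain \<F> \<F>' where "S = \<Inter>\<F>" "finite \<F>" "\<F> \<noteq> {}" "\<F> \<subseteq> \<K>"
          "T = \<Inter>\<F>'" "finite \<F>'" "\<F>' \<subseteq> \<K>"
          unfolding \<G>_def by blast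
        then have "\<Inter>(\<F> \<union> \<F>') \<in> \<G>" "\<Inter>(\<F> \<union> \<F>') \<subseteq> S \<inter> T"
          unfolding \<G>_def by (blast, auto)
        then show "\<exists>R\<in>\<G>. R \<subseteq> S \<inter> T"
          by blast
      qed
      then show False
        using U single by blast
    qed
    then obtain S where S: "S \<in> \<G>" "S \<subseteq> \<Union>\<U>"
      by blast
    have "compactin (scott_topology L) S"
      using G[OF S(1)] by simp
    from compactinD[OF this _ S(2)] U
    obtain \<F> where "finite \<F>" "\<F> \<subseteq> \<U>" "S \<subseteq> \<Union>\<F>"
      by auto
    moreover have "\<Inter>\<K> \<subseteq> S"
      using S(1) unfolding \<G>_def by blast
    ultimately show "\<exists>\<F>. finite \<F> \<and> \<F> \<subseteq> \<U> \<and> \<Inter>\<K> \<subseteq> \<Union>\<F>"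
      by (meson order_trans)
  qed
qed

text \<open>An open set containing \<open>\<bottom>\<close> is the whole carrier. Under reverse
  inclusion this is the least element, the join of the empty family.\<close>

lemma compact_saturated_carrier: "compact_saturated (carrier L)"
proof
  show sat: "saturated_in (scott_topology L) (carrier L)"
    unfolding saturated_in_scott by blast
  show "compactin (scott_topology L) (carrier L)"
    unfolding compactin_def
  proof (intro conjI allI impI)
    show "carrier L \<subseteq> topspace (scott_topology L)"
      by (simp add: topspace_scott_topology weak_partial_order_axioms)
    fix \<U> assume U: "Ball \<U> (openin (scott_topology L)) \<and> carrier L \<subseteq> \<Union>\<U>"
    then obtain V where V: "V \<in> \<U>" "\<bottom> \<in> V"
      using bottom_closed by blast
    then have "scott_open L V"
      using U by (auto simp: openin_scott_topology weak_partial_order_axioms)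
    then have "carrier L \<subseteq> V"
      using scott_open_upward[OF _ V(2)] bottom_lower by auto
    then show "\<exists>\<F>. finite \<F> \<and> \<F> \<subseteq> \<U> \<and> carrier L \<subseteq> \<Union>\<F>"
      using V(1) by (intro exI[of _ "{V}"]) auto
  qed
qed

text \<open>Gives all nonempty saturated sets a common point, so that their intersections are
  nonempty.\<close>

lemma top_mem_saturated:
  "\<lbrakk>K \<noteq> {}; saturated_in (scott_topology L) K\<rbrakk> \<Longrightarrow> \<top> \<in> K"
  unfolding saturated_in_scott by (meson ex_in_conv subsetD top_closed top_higher)

end

section \<open>The frame of nonempty compact saturated sets\<close>

theorem lemma1:
  fixes L :: "('a, 'b) gorder_scheme"
  assumes "complete_lattice L"
  shows "complete_heyting_algebra (compact_saturated_order (scott_topology L))"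
proof -
  interpret L: complete_lattice L
    by (rule assms)
  let ?P = "compact_saturated_order (scott_topology L)"
  have carrier: "K \<in> carrier ?P \<longleftrightarrow> K \<noteq> {} \<and> L.compact_saturated K" for K
    by (simp add: compact_saturated_order_def)
  have le: "K\<^sub>1 \<sqsubseteq>\<^bsub>?P\<^esub> K\<^sub>2 \<longleftrightarrow> K\<^sub>2 \<subseteq> K\<^sub>1" for K\<^sub>1 K\<^sub>2
    by (simp add: compact_saturated_order_def)
  have eq: "K\<^sub>1 .=\<^bsub>?P\<^esub> K\<^sub>2 \<longleftrightarrow> K\<^sub>1 = K\<^sub>2" for K\<^sub>1 K\<^sub>2
    by (simp add: compact_saturated_order_def)
  \<comment> \<open>The factor \<open>carrier L\<close> changes the intersection only for
    \<open>S = {}\<close>, where it gives the least element.\<close>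
  have Inter_closed: "carrier L \<inter> \<Inter>S \<in> carrier ?P" if "S \<subseteq> carrier ?P" for S
  proof -
    have mem: "L.compact_saturated K \<and> K \<noteq> {}" if "K \<in> insert (carrier L) S" for K
      using that \<open>S \<subseteq> carrier ?P\<close> carrier L.compact_saturated_carrier L.top_closed by blast
    then have "L.compact_saturated (\<Inter>(insert (carrier L) S))"
      by (intro L.compact_saturated_Inter) blast+
    moreover have "\<top>\<^bsub>L\<^esub> \<in> \<Inter>(insert (carrier L) S)"
      using mem L.top_mem_saturated by blast
    ultimately show ?thesis
      unfolding carrier by auto
  qed
  have sub: "K \<subseteq> carrier L" if "K \<in> carrier ?P" for K
    using that L.saturated_in_scott_carrier carrier by blast
  have lub: "is_lub ?P (carrier L \<inter> \<Inter>S) S" if S: "S \<subseteq> carrier ?P" for S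
    using Inter_closed[OF S] S sub unfolding least_def Upper_def le by blast
  interpret P: complete_lattice ?P
  proof
    show "\<exists>s. is_lub ?P s S" if "S \<subseteq> carrier ?P" for S
      using lub[OF that] by blast
    show "\<exists>i. is_glb ?P i S" if S: "S \<subseteq> carrier ?P" for S
    proof
      \<comment> \<open>General infima are taken as joins of all lower bounds; only binary meets get
        an explicit form, in \<open>meet\<close>.\<close>
      have "Lower ?P S \<subseteq> carrier ?P"
        by (auto simp: Lower_def)
      from Inter_closed[OF this]
      show "is_glb ?P (carrier L \<inter> \<Inter>(Lower ?P S)) S"
        using S sub unfolding greatest_def Lower_def le by blast
    qed
  qed (auto simp: le eq fun_eq_iff)
  have sup: "\<Squnion>\<^bsub>?P\<^esub>S = carrier L \<inter> \<Inter>S" if "S \<subseteq> carrier ?P" for S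
    using P.least_unique[OF P.sup_lub lub] that by blast
  have Un_closed: "a \<union> b \<in> carrier ?P" if "a \<in> carrier ?P" "b \<in> carrier ?P" for a b
    using that unfolding carrier L.saturated_in_scott by (auto intro: compactin_Un)
  have meet: "a \<sqinter>\<^bsub>?P\<^esub> b = a \<union> b" if "a \<in> carrier ?P" "b \<in> carrier ?P" for a b
  proof -
    have "is_glb ?P (a \<union> b) {a, b}"
      using Un_closed[OF that] that unfolding greatest_def Lower_def le by blast
    moreover have "is_glb ?P (a \<sqinter>\<^bsub>?P\<^esub> b) {a, b}"
      unfolding meet_def using that by (intro P.inf_glb) auto
    ultimately show ?thesis
      using P.greatest_unique by blast
  qed
  show ?thesis
  proof
    fix a S assume a: "a \<in> carrier ?P" and S: "S \<subseteq> carrier ?P"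
    have img: "(\<lambda>s. a \<sqinter>\<^bsub>?P\<^esub> s) ` S = (\<lambda>s. a \<union> s) ` S"
      using meet a S by (intro image_cong) auto
    have "a \<sqinter>\<^bsub>?P\<^esub> \<Squnion>\<^bsub>?P\<^esub>S = a \<union> (carrier L \<inter> \<Inter>S)"
      using meet[OF a P.sup_closed[OF S]] sup[OF S] by simp
    \<comment> \<open>Union distributes over intersection, and
      \<open>a \<subseteq> carrier L\<close> absorbs \<open>a\<close> into the first factor; for
      \<open>S = {}\<close> both sides are \<open>carrier L\<close>.\<close>
    also have "\<dots> = carrier L \<inter> \<Inter>((\<lambda>s. a \<union> s) ` S)"
      using sub[OF a] by blast
    also have "\<dots> = \<Squnion>\<^bsub>?P\<^esub>((\<lambda>s. a \<union> s) ` S)"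
      using Un_closed[OF a] S by (intro sup[symmetric]) auto
    finally show "a \<sqinter>\<^bsub>?P\<^esub> \<Squnion>\<^bsub>?P\<^esub>S = \<Squnion>\<^bsub>?P\<^esub>((\<lambda>s. a \<sqinter>\<^bsub>?P\<^esub> s) ` S)"
      unfolding img .
  qed
qed

end
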